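(* Let $H\in(0,1]$ and let $X=\{X_f,\ f\in L^2(T,m)\}$ be a real-valued Gaussian process. Then $X$ is, up to normalization of its variance, an $L^2$-fractional Brownian motion, namely $X$ is centred and there is a constant $\sigma^2\ge 0$ with $$\mathbb{E}(X_fX_g)=\frac{\sigma^2}{2}\left(\|f\|^{2H}+\|g\|^{2H}-\|f-g\|^{2H}\right)\quad\text{for all } f,g\in L^2(T,m),$$ if and only if $X$ satisfies both of the following properties: (SS1) ($H$-self-similarity) for every $a>0$, $\{a^{-H}X_{af},\ f\in L^2(T,m)\}\overset{(d)}{=}\{X_f,\ f\in L^2(T,m)\}$; (SI1) (strong $L^2$-increment stationarity) for every $\psi:L^2(T,m)\to L^2(T,m)$ that is a translation or an orthogonal transformation, $\{X_{\psi(f)}-X_{\psi(0)},\ f\in L^2(T,m)\}\overset{(d)}{=}\{X_f-X_0,\ f\in L^2(T,m)\}$.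
   Context: $T$ is a separable and complete metric space with a measure $m$ such that the real Hilbert space $L^2(T,m)$ is separable; $\|\cdot\|$ is the norm of $L^2(T,m)$. $\overset{(d)}{=}$ means equality of finite-dimensional distributions. "Gaussian process" is not assumed centred a priori, and constants are regarded as (degenerate) Gaussian variables. In the paper's parametrization, the $L^2(T,m)$-fractional Brownian motion of parameter $H'\in(0,1/2]$ is the centred Gaussian process with covariance $\frac12\left(m(f^2)^{2H'}+m(g^2)^{2H'}-m((f-g)^2)^{2H'}\right)$, where $m(f^2)=\int_T f^2\,\mathrm{d}m=\|f\|^2$; the process in the claim with $\sigma^2=1$ is the one with $H'=H/2$. *)

theory Defs
  imports "HOL-Probability.Probability"
begin

section \<open>The Hilbert space of square-integrable functions\<close>

text \<open>
  The space depends on the measure \<open>m\<close>, so it is a carrier set of almost-everywhere classes,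
  with operations on classes, rather than a type.
\<close>

definition L2_fun :: "'t measure \<Rightarrow> ('t \<Rightarrow> real) set" where
  "L2_fun m = {f \<in> borel_measurable m. integrable m (\<lambda>x. (f x)\<^sup>2)}"

definition L2_eq :: "'t measure \<Rightarrow> (('t \<Rightarrow> real) \<times> ('t \<Rightarrow> real)) set" where
  "L2_eq m = {(f, g). f \<in> L2_fun m \<and> g \<in> L2_fun m \<and> (AE x in m. f x = g x)}"

definition L2 :: "'t measure \<Rightarrow> ('t \<Rightarrow> real) set set" where
  "L2 m = L2_fun m // L2_eq m"

definition L2_class :: "'t measure \<Rightarrow> ('t \<Rightarrow> real) \<Rightarrow> ('t \<Rightarrow> real) set" where
  "L2_class m f = L2_eq m `` {f}"

text \<open>
  The operations choose representatives; their independence of the choice is proved in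
  \<open>L2_add_class\<close>, \<open>L2_diff_class\<close>, \<open>L2_scale_class\<close> and \<open>L2_inner_class\<close>.
\<close>

definition L2_rep :: "('t \<Rightarrow> real) set \<Rightarrow> 't \<Rightarrow> real" where
  "L2_rep F = (SOME f. f \<in> F)"

definition L2_zero :: "'t measure \<Rightarrow> ('t \<Rightarrow> real) set" where
  "L2_zero m = L2_class m (\<lambda>_. 0)"

definition L2_add :: "'t measure \<Rightarrow> ('t \<Rightarrow> real) set \<Rightarrow> ('t \<Rightarrow> real) set \<Rightarrow> ('t \<Rightarrow> real) set" where
  "L2_add m F G = L2_class m (\<lambda>x. L2_rep F x + L2_rep G x)"

definition L2_diff :: "'t measure \<Rightarrow> ('t \<Rightarrow> real) set \<Rightarrow> ('t \<Rightarrow> real) set \<Rightarrow> ('t \<Rightarrow> real) set" where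
  "L2_diff m F G = L2_class m (\<lambda>x. L2_rep F x - L2_rep G x)"

definition L2_scale :: "'t measure \<Rightarrow> real \<Rightarrow> ('t \<Rightarrow> real) set \<Rightarrow> ('t \<Rightarrow> real) set" where
  "L2_scale m a F = L2_class m (\<lambda>x. a * L2_rep F x)"

definition L2_inner :: "'t measure \<Rightarrow> ('t \<Rightarrow> real) set \<Rightarrow> ('t \<Rightarrow> real) set \<Rightarrow> real" where
  "L2_inner m F G = (\<integral>x. L2_rep F x * L2_rep G x \<partial>m)"

definition L2_norm :: "'t measure \<Rightarrow> ('t \<Rightarrow> real) set \<Rightarrow> real" where
  "L2_norm m F = sqrt (L2_inner m F F)"

definition L2_separable :: "'t measure \<Rightarrow> bool" where
  "L2_separable m \<longleftrightarrow>
     (\<exists>D. countable D \<and> D \<subseteq> L2 m \<and>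
          (\<forall>f\<in>L2 m. \<forall>e>0. \<exists>d\<in>D. L2_norm m (L2_diff m f d) < e))"

definition L2_translation ::
    "'t measure \<Rightarrow> (('t \<Rightarrow> real) set \<Rightarrow> ('t \<Rightarrow> real) set) \<Rightarrow> bool" where
  "L2_translation m \<psi> \<longleftrightarrow> (\<exists>h\<in>L2 m. \<forall>f\<in>L2 m. \<psi> f = L2_add m f h)"

text \<open>
  In infinite dimension, a linear map preserving the inner product need not be onto; an orthogonal
  transformation is required to be invertible.
\<close>

definition L2_orthogonal ::
    "'t measure \<Rightarrow> (('t \<Rightarrow> real) set \<Rightarrow> ('t \<Rightarrow> real) set) \<Rightarrow> bool" where
  "L2_orthogonal m \<psi> \<longleftrightarrow>
     bij_betw \<psi> (L2 m) (L2 m) \<and>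
     (\<forall>f\<in>L2 m. \<forall>g\<in>L2 m. \<psi> (L2_add m f g) = L2_add m (\<psi> f) (\<psi> g)) \<and>
     (\<forall>a. \<forall>f\<in>L2 m. \<psi> (L2_scale m a f) = L2_scale m a (\<psi> f)) \<and>
     (\<forall>f\<in>L2 m. \<forall>g\<in>L2 m. L2_inner m (\<psi> f) (\<psi> g) = L2_inner m f g)"

lemma equiv_L2_eq: "equiv (L2_fun m) (L2_eq m)"
proof (rule equivI)
  show "L2_eq m \<subseteq> L2_fun m \<times> L2_fun m" by (auto simp: L2_eq_def)
  show "refl_on (L2_fun m) (L2_eq m)" by (auto simp: refl_on_def L2_eq_def)
  show "sym (L2_eq m)" by (auto simp: sym_def L2_eq_def eq_commute)
  show "trans (L2_eq m)" by (rule transI) (auto simp: L2_eq_def elim: AE_mp)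
qed

lemma L2_class_eq_iff:
  "f \<in> L2_fun m \<Longrightarrow> g \<in> L2_fun m \<Longrightarrow> L2_class m f = L2_class m g \<longleftrightarrow> (AE x in m. f x = g x)"
  using eq_equiv_class_iff[OF equiv_L2_eq, of f m g] by (auto simp: L2_class_def L2_eq_def)

lemma L2_class_in_L2: "f \<in> L2_fun m \<Longrightarrow> L2_class m f \<in> L2 m"
  by (simp add: L2_def L2_class_def quotientI)

lemma L2_cases:
  assumes "F \<in> L2 m"
  obtains f where "f \<in> L2_fun m" "F = L2_class m f"
  using assms by (auto simp: L2_def L2_class_def elim: quotientE)

lemma L2_rep_class:
  assumes "f \<in> L2_fun m"
  shows "L2_rep (L2_class m f) \<in> L2_fun m" "AE x in m. L2_rep (L2_class m f) x = f x"
proof -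
  have "f \<in> L2_class m f" using assms by (simp add: L2_class_def L2_eq_def)
  then have "L2_rep (L2_class m f) \<in> L2_class m f" unfolding L2_rep_def by (rule someI[where P = "\<lambda>h. h \<in> L2_class m f"])
  then show "L2_rep (L2_class m f) \<in> L2_fun m" "AE x in m. L2_rep (L2_class m f) x = f x"
    by (auto simp: L2_class_def L2_eq_def eq_commute)
qed

lemma L2_fun_scale: "f \<in> L2_fun m \<Longrightarrow> (\<lambda>x. a * f x) \<in> L2_fun m"
  by (auto simp: L2_fun_def power_mult_distrib)

lemma L2_fun_zero: "(\<lambda>_. 0) \<in> L2_fun m"
  by (auto simp: L2_fun_def)

lemma L2_fun_add:
  assumes "f \<in> L2_fun m" "g \<in> L2_fun m"
  shows "(\<lambda>x. f x + g x) \<in> L2_fun m"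
proof -
  have [measurable]: "f \<in> borel_measurable m" "g \<in> borel_measurable m"
    using assms by (auto simp: L2_fun_def)
  have "integrable m (\<lambda>x. (f x + g x)\<^sup>2)"
  proof (rule Bochner_Integration.integrable_bound)
    show "integrable m (\<lambda>x. 2 * (f x)\<^sup>2 + 2 * (g x)\<^sup>2)"
      using assms by (auto simp: L2_fun_def)
    have "(f x + g x)\<^sup>2 \<le> 2 * (f x)\<^sup>2 + 2 * (g x)\<^sup>2" for x
      using zero_le_power2[of "f x - g x"] by (simp add: power2_eq_square algebra_simps)
    then show "AE x in m. norm ((f x + g x)\<^sup>2) \<le> norm (2 * (f x)\<^sup>2 + 2 * (g x)\<^sup>2)"
      by auto
  qed measurable
  then show ?thesis by (simp add: L2_fun_def)
qed

lemma L2_fun_diff: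
  "f \<in> L2_fun m \<Longrightarrow> g \<in> L2_fun m \<Longrightarrow> (\<lambda>x. f x - g x) \<in> L2_fun m"
  using L2_fun_add[of f m "\<lambda>x. (-1) * g x"] L2_fun_scale[of g m "-1"] by simp

lemma L2_add_class:
  assumes "f \<in> L2_fun m" "g \<in> L2_fun m"
  shows "L2_add m (L2_class m f) (L2_class m g) = L2_class m (\<lambda>x. f x + g x)"
  unfolding L2_add_def
  using L2_rep_class[OF assms(1)] L2_rep_class[OF assms(2)] assms
  by (subst L2_class_eq_iff) (auto intro: L2_fun_add elim!: AE_mp)

lemma L2_diff_class:
  assumes "f \<in> L2_fun m" "g \<in> L2_fun m"
  shows "L2_diff m (L2_class m f) (L2_class m g) = L2_class m (\<lambda>x. f x - g x)"
  unfolding L2_diff_def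
  using L2_rep_class[OF assms(1)] L2_rep_class[OF assms(2)] assms
  by (subst L2_class_eq_iff) (auto intro: L2_fun_diff elim!: AE_mp)

lemma L2_scale_class:
  assumes "f \<in> L2_fun m"
  shows "L2_scale m a (L2_class m f) = L2_class m (\<lambda>x. a * f x)"
  unfolding L2_scale_def
  using L2_rep_class[OF assms] assms
  by (subst L2_class_eq_iff) (auto intro: L2_fun_scale elim!: AE_mp)

lemma L2_inner_class:
  assumes "f \<in> L2_fun m" "g \<in> L2_fun m"
  shows "L2_inner m (L2_class m f) (L2_class m g) = (\<integral>x. f x * g x \<partial>m)"
  unfolding L2_inner_def
proof (rule integral_cong_AE)
  note r = L2_rep_class[OF assms(1)] L2_rep_class[OF assms(2)]
  show "(\<lambda>x. L2_rep (L2_class m f) x * L2_rep (L2_class m g) x) \<in> borel_measurable m"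
    using r by (auto simp: L2_fun_def)
  show "(\<lambda>x. f x * g x) \<in> borel_measurable m"
    using assms by (auto simp: L2_fun_def)
  show "AE x in m. L2_rep (L2_class m f) x * L2_rep (L2_class m g) x = f x * g x"
    using r(2,4) by eventually_elim simp
qed


section \<open>Gaussian processes\<close>

text \<open>The second disjunct is the degenerate case of variance zero.\<close>

definition gaussian_rv :: "'w measure \<Rightarrow> ('w \<Rightarrow> real) \<Rightarrow> bool" where
  "gaussian_rv M Y \<longleftrightarrow>
     (\<exists>\<mu> \<sigma>. 0 < \<sigma> \<and> distributed M lborel Y (\<lambda>x. ennreal (normal_density \<mu> \<sigma> x))) \<or>
     (Y \<in> borel_measurable M \<and> (\<exists>\<mu>. AE \<omega> in M. Y \<omega> = \<mu>))"

definition gaussian_process :: "'w measure \<Rightarrow> 'i set \<Rightarrow> ('i \<Rightarrow> 'w \<Rightarrow> real) \<Rightarrow> bool" where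
  "gaussian_process M I X \<longleftrightarrow>
     (\<forall>i\<in>I. X i \<in> borel_measurable M) \<and>
     (\<forall>J c. finite J \<and> J \<subseteq> I \<longrightarrow> gaussian_rv M (\<lambda>\<omega>. \<Sum>j\<in>J. c j * X j \<omega>))"

definition fdd_eq ::
    "'w measure \<Rightarrow> 'i set \<Rightarrow> ('i \<Rightarrow> 'w \<Rightarrow> real) \<Rightarrow> ('i \<Rightarrow> 'w \<Rightarrow> real) \<Rightarrow> bool" where
  "fdd_eq M I X Y \<longleftrightarrow>
     (\<forall>J. finite J \<and> J \<subseteq> I \<longrightarrow>
        distr M (\<Pi>\<^sub>M j\<in>J. borel) (\<lambda>\<omega>. \<lambda>j\<in>J. X j \<omega>) =
        distr M (\<Pi>\<^sub>M j\<in>J. borel) (\<lambda>\<omega>. \<lambda>j\<in>J. Y j \<omega>))"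


section \<open>Invariance properties of processes indexed by the Hilbert space\<close>

definition L2_self_similar ::
    "'w measure \<Rightarrow> 't measure \<Rightarrow> real \<Rightarrow> (('t \<Rightarrow> real) set \<Rightarrow> 'w \<Rightarrow> real) \<Rightarrow> bool" where
  "L2_self_similar M m H X \<longleftrightarrow>
     (\<forall>a>0. fdd_eq M (L2 m) (\<lambda>f \<omega>. a powr (-H) * X (L2_scale m a f) \<omega>) X)"

definition L2_strong_increment_stationary ::
    "'w measure \<Rightarrow> 't measure \<Rightarrow> (('t \<Rightarrow> real) set \<Rightarrow> 'w \<Rightarrow> real) \<Rightarrow> bool" where
  "L2_strong_increment_stationary M m X \<longleftrightarrow>
     (\<forall>\<psi>\<in>L2 m \<rightarrow> L2 m. L2_translation m \<psi> \<or> L2_orthogonal m \<psi> \<longrightarrow>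
        fdd_eq M (L2 m)
          (\<lambda>f \<omega>. X (\<psi> f) \<omega> - X (\<psi> (L2_zero m)) \<omega>)
          (\<lambda>f \<omega>. X f \<omega> - X (L2_zero m) \<omega>))"

end

theory Submission imports Defs begin

text \<open>
  Suppose that the process is self-similar and has strongly stationary increments. Scaling fixes the
  zero vector, so \<open>X\<close> vanishes there almost surely, and stationarity compares \<open>X\<close> with its own
  increments. The map \<open>f \<mapsto> - f\<close> is orthogonal and translation by \<open>- f\<close> carries \<open>f\<close> to zero; together
  they force the mean to vanish. Two vectors of equal norm are exchanged by a reflection
  (\<open>L2_orthogonal_transitive_on_spheres\<close>), so the variance of \<open>X f\<close> depends only on the norm of \<open>f\<close>, and
  by self-similarity it is \<open>s \<parallel>f\<parallel>\<^bsup>2H\<^esup>\<close>. Translation gives the same formula for the variance of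
  \<open>X f - X g\<close> in terms of \<open>f - g\<close>, and the covariance follows by polarisation.

  Conversely, let \<open>X\<close> be centred with the stated covariance. The kernel is homogeneous of degree
  \<open>2H\<close>, and the covariance of increments depends only on distances in the index space, which
  translations and orthogonal maps preserve. So the processes to be compared are Gaussian with the
  same mean and the same covariance. That they then have the same finite-dimensional distributions
  (\<open>gaussian_process_fdd_eqI\<close>) rests on the Cramer--Wold theorem
  (\<open>distr_PiM_eqI_linear_combinations\<close>): a law on a finite product of lines is determined by the laws of
  all linear combinations of its coordinates. It is derived from Levy's uniqueness theorem on the
  line, applied to one coordinate at a time with trigonometric functions of the others as weights.
\<close>

section \<open>Equality of joint distributions from linear combinations\<close>

text \<open>
  Normalising a nonnegative weight turns it into a probability density, so that integrals against
  the weight become integrals against a law on the line and one-dimensional Levy uniqueness applies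
  to them.
\<close>
lemma weighted_law:
  fixes u F :: "'a \<Rightarrow> real"
  assumes F[measurable]: "F \<in> borel_measurable L" and u: "integrable L u" "\<And>x. 0 \<le> u x"
    and c: "c = (\<integral>x. u x \<partial>L)" "0 < c"
  defines "D \<equiv> distr (density L (\<lambda>x. ennreal (u x / c))) borel F"
  shows real_distribution_weighted_law: "real_distribution D"
    and char_weighted_law: "char D t = Complex ((\<integral>x. u x * cos (t * F x) \<partial>L) / c) ((\<integral>x. u x * sin (t * F x) \<partial>L) / c)"
    and measure_weighted_law: "A \<in> sets borel \<Longrightarrow> measure D A = (\<integral>x. u x * indicator A (F x) \<partial>L) / c"
proof -
  have [measurable]: "u \<in> borel_measurable L" using u by auto
  let ?D = "density L (\<lambda>x. ennreal (u x / c))"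
  have "emeasure ?D (space ?D) = (\<integral>\<^sup>+x. ennreal (u x / c) \<partial>L)"
    by (subst emeasure_density) (auto intro!: nn_integral_cong)
  also have "\<dots> = 1"
    using u c by (subst nn_integral_eq_integral) auto
  finally have p: "prob_space ?D" by (rule prob_spaceI)
  show "real_distribution D"
    using prob_space.prob_space_distr[OF p, of F borel]
    by (auto simp: D_def real_distribution_def real_distribution_axioms_def)
  have i: "integrable L (\<lambda>x. u x * cos (t * F x))" "integrable L (\<lambda>x. u x * sin (t * F x))"
    by (auto intro!: Bochner_Integration.integrable_bound[OF u(1)] simp: abs_mult mult_left_le)
  have "char D t = (CLINT x|?D. iexp (t * F x))"
    unfolding char_def D_def by (subst integral_distr) auto
  also have "\<dots> = (CLINT x|L. (u x / c) *\<^sub>R iexp (t * F x))"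
    using c u by (subst integral_density) auto
  also have "\<dots> = (CLINT x|L. complex_of_real (u x * cos (t * F x) / c) + \<i> * complex_of_real (u x * sin (t * F x) / c))"
    by (intro Bochner_Integration.integral_cong refl) (auto simp: complex_eq_iff Re_exp Im_exp)
  also have "\<dots> = Complex ((\<integral>x. u x * cos (t * F x) \<partial>L) / c) ((\<integral>x. u x * sin (t * F x) \<partial>L) / c)"
    using i by (subst Bochner_Integration.integral_add)
      (auto simp: complex_eq_iff simp del: of_real_mult of_real_divide)
  finally show "char D t = Complex ((\<integral>x. u x * cos (t * F x) \<partial>L) / c) ((\<integral>x. u x * sin (t * F x) \<partial>L) / c)" .
  assume [measurable]: "A \<in> sets borel"
  have "measure D A = (\<integral>x. indicator A (F x) \<partial>?D)"
    unfolding D_def by (subst integral_distr[symmetric, where g = F and N = borel]) auto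
  also have "\<dots> = (\<integral>x. (u x / c) *\<^sub>R indicator A (F x) \<partial>L)"
    using c u by (subst integral_density) auto
  finally show "measure D A = (\<integral>x. u x * indicator A (F x) \<partial>L) / c" by simp
qed

text \<open>
  The phase \<open>\<phi>\<close> makes cosines suffice: a shift by a quarter period gives the sine, that is, the
  imaginary part of the characteristic function.
\<close>
lemma weighted_Levy_uniqueness:
  fixes w Y :: "'a \<Rightarrow> real" and v Z :: "'b \<Rightarrow> real"
  assumes w: "integrable M w" "\<And>x. 0 \<le> w x" and v: "integrable N v" "\<And>x. 0 \<le> v x"
    and Y[measurable]: "Y \<in> borel_measurable M" and Z[measurable]: "Z \<in> borel_measurable N"
    and eq: "\<And>t \<phi>. (\<integral>x. w x * cos (t * Y x + \<phi>) \<partial>M) = (\<integral>x. v x * cos (t * Z x + \<phi>) \<partial>N)"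
    and A[measurable]: "A \<in> sets borel"
  shows "(\<integral>x. w x * indicator A (Y x) \<partial>M) = (\<integral>x. v x * indicator A (Z x) \<partial>N)"
proof -
  define c where "c = (\<integral>x. w x \<partial>M)"
  have c': "c = (\<integral>x. v x \<partial>N)" using eq[of 0 0] by (simp add: c_def)
  have [measurable]: "w \<in> borel_measurable M" "v \<in> borel_measurable N" using w v by auto
  show ?thesis
  proof (cases "c = 0")
    case True
    have "AE x in M. w x = 0" using True w by (simp add: c_def integral_nonneg_eq_0_iff_AE)
    then have "(\<integral>x. w x * indicator A (Y x) \<partial>M) = 0"
      by (subst integral_cong_AE[where g="\<lambda>_. 0"]) auto
    moreover have "AE x in N. v x = 0" using True v by (simp add: c' integral_nonneg_eq_0_iff_AE)
    then have "(\<integral>x. v x * indicator A (Z x) \<partial>N) = 0"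
      by (subst integral_cong_AE[where g="\<lambda>_. 0"]) auto
    ultimately show ?thesis by simp
  next
    case False
    then have c: "c > 0" using w by (simp add: c_def less_le)
    have "sin y = cos (y + (- pi / 2))" for y :: real by (simp add: cos_diff)
    then have s: "(\<integral>x. w x * sin (t * Y x) \<partial>M) = (\<integral>x. v x * sin (t * Z x) \<partial>N)" for t
      using eq[of t "- pi / 2"] by simp
    note W = weighted_law[OF Y w c_def c] and V = weighted_law[OF Z v c' c]
    have "distr (density M (\<lambda>x. ennreal (w x / c))) borel Y = distr (density N (\<lambda>x. ennreal (v x / c))) borel Z"
      using eq[of _ 0] by (intro Levy_uniqueness W(1) V(1) ext) (simp add: W(2) V(2) s)
    then show ?thesis using W(3)[OF A] V(3)[OF A] c by auto
  qed
qed

text \<open>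
  This is the induction behind the Cramer--Wold theorem. For \<open>K = {}\<close> it speaks of the laws of linear
  combinations only; for \<open>K = J\<close>, \<open>t = 0\<close> and \<open>\<phi> = 0\<close> it says that both vectors give every box the same
  probability. To move one more index \<open>k\<close> into \<open>K\<close>, the phase is treated as a weight: \<open>w (1 + cos p)\<close>,
  with \<open>w\<close> the product of indicators and \<open>p\<close> the linear combination, is nonnegative, and its product
  with \<open>cos (s Y\<^sub>k + \<psi>)\<close> splits into cosines of linear combinations, to which the induction hypothesis
  applies. Weighted Levy uniqueness then permits the factor \<open>indicator (A k) (Y k)\<close>, and subtracting
  the same statement for the weight \<open>w\<close> alone leaves the term with \<open>cos p\<close>.
\<close>
lemma integral_indicator_cos_eq:
  fixes Y :: "'i \<Rightarrow> 'a \<Rightarrow> real" and Z :: "'i \<Rightarrow> 'b \<Rightarrow> real"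
  assumes "prob_space M" "prob_space N"
    and [measurable]: "\<And>j. j \<in> J \<Longrightarrow> Y j \<in> borel_measurable M" "\<And>j. j \<in> J \<Longrightarrow> Z j \<in> borel_measurable N"
    and J: "finite J" "K \<subseteq> J"
    and eq: "\<And>t. distr M borel (\<lambda>x. \<Sum>j\<in>J. t j * Y j x) = distr N borel (\<lambda>x. \<Sum>j\<in>J. t j * Z j x)"
    and A: "\<And>j. j \<in> J \<Longrightarrow> A j \<in> sets borel"
  shows "(\<integral>x. (\<Prod>j\<in>K. indicator (A j) (Y j x)) * cos ((\<Sum>j\<in>J. t j * Y j x) + \<phi>) \<partial>M)
       = (\<integral>x. (\<Prod>j\<in>K. indicator (A j) (Z j x)) * cos ((\<Sum>j\<in>J. t j * Z j x) + \<phi>) \<partial>N)"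
proof -
  interpret M: prob_space M by fact
  interpret N: prob_space N by fact
  have [measurable]: "A j \<in> sets borel" if "j \<in> J" for j using A that .
  have fK: "finite K" using J finite_subset by blast
  show ?thesis
    using fK \<open>K \<subseteq> J\<close>
  proof (induction K arbitrary: t \<phi>)
    case empty
    have "(\<integral>x. cos (x + \<phi>) \<partial>distr M borel (\<lambda>x. \<Sum>j\<in>J. t j * Y j x))
      = (\<integral>x. cos (x + \<phi>) \<partial>distr N borel (\<lambda>x. \<Sum>j\<in>J. t j * Z j x))"
      by (simp only: eq)
    then show ?case by (simp add: integral_distr)
  next
    case (insert k K)
    then have k[measurable]: "k \<in> J" and KJ: "K \<subseteq> J" by auto
    note IH = insert.IH[OF KJ]
    define w where "w x = (\<Prod>j\<in>K. indicator (A j) (Y j x) :: real)" for x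
    define v where "v x = (\<Prod>j\<in>K. indicator (A j) (Z j x) :: real)" for x
    have w01: "0 \<le> w x" "w x \<le> 1" for x
      unfolding w_def by (auto intro!: prod_nonneg prod_le_1 split: split_indicator)
    have v01: "0 \<le> v x" "v x \<le> 1" for x
      unfolding v_def by (auto intro!: prod_nonneg prod_le_1 split: split_indicator)
    have [measurable]: "w \<in> borel_measurable M" "v \<in> borel_measurable N"
      unfolding w_def v_def using KJ by (auto intro!: borel_measurable_prod)
    define p where "p t \<phi> x = (\<Sum>j\<in>J. t j * Y j x) + \<phi>" for t \<phi> x
    define q where "q t \<phi> x = (\<Sum>j\<in>J. t j * Z j x) + \<phi>" for t \<phi> x
    have [measurable]: "p t \<phi> \<in> borel_measurable M" "q t \<phi> \<in> borel_measurable N" for t \<phi>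
      unfolding p_def q_def by auto
    have IH': "(\<integral>x. w x * cos (p t \<phi> x) \<partial>M) = (\<integral>x. v x * cos (q t \<phi> x) \<partial>N)" for t \<phi>
      using IH unfolding w_def v_def p_def q_def .
    have iw: "integrable M (\<lambda>x. w x * cos (h x))" if [measurable]: "h \<in> borel_measurable M" for h
      using w01 by (intro M.integrable_const_bound[where B=1]) (auto simp: abs_mult intro!: mult_le_one)
    have iv: "integrable N (\<lambda>x. v x * cos (h x))" if [measurable]: "h \<in> borel_measurable N" for h
      using v01 by (intro N.integrable_const_bound[where B=1]) (auto simp: abs_mult intro!: mult_le_one)
    \<comment> \<open>Coefficients that single out \<open>k\<close>, so that \<open>s * Y k x + \<phi>\<close> is one of the combinations \<open>p\<close>.\<close>
    define e where "e s = (\<lambda>j. if j = k then s else 0 :: real)" for s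
    have e1: "p (e s) \<phi> x = s * Y k x + \<phi>" for s \<phi> x
      using k J by (simp add: p_def e_def if_distrib[of "\<lambda>z. z * _"] cong: if_cong)
    have e2: "q (e s) \<phi> x = s * Z k x + \<phi>" for s \<phi> x
      using k J by (simp add: q_def e_def if_distrib[of "\<lambda>z. z * _"] cong: if_cong)
    have pa: "p a \<phi> x + p b \<psi> x = p (\<lambda>j. a j + b j) (\<phi> + \<psi>) x" 
             "p a \<phi> x - p b \<psi> x = p (\<lambda>j. a j - b j) (\<phi> - \<psi>) x" for a b \<phi> \<psi> x
      by (simp_all add: p_def algebra_simps sum.distrib sum_subtractf)
    have qa: "q a \<phi> x + q b \<psi> x = q (\<lambda>j. a j + b j) (\<phi> + \<psi>) x" 
             "q a \<phi> x - q b \<psi> x = q (\<lambda>j. a j - b j) (\<phi> - \<psi>) x" for a b \<phi> \<psi> x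
      by (simp_all add: q_def algebra_simps sum.distrib sum_subtractf)
    have cc: "(1 + cos a) * cos b = cos b + (cos (a - b) + cos (a + b)) / 2" for a b :: real
      by (simp add: cos_add cos_diff algebra_simps)
    have pm: "w x * (1 + cos (p t \<phi> x)) * cos (s * Y k x + \<psi>) = w x * cos (p (e s) \<psi> x)
        + (w x * cos (p (\<lambda>j. t j - e s j) (\<phi> - \<psi>) x) + w x * cos (p (\<lambda>j. t j + e s j) (\<phi> + \<psi>) x)) / 2" for x s \<psi>
      unfolding mult.assoc e1[symmetric] cc pa by (simp add: algebra_simps)
    have qm: "v x * (1 + cos (q t \<phi> x)) * cos (s * Z k x + \<psi>) = v x * cos (q (e s) \<psi> x)
        + (v x * cos (q (\<lambda>j. t j - e s j) (\<phi> - \<psi>) x) + v x * cos (q (\<lambda>j. t j + e s j) (\<phi> + \<psi>) x)) / 2" for x s \<psi>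
      unfolding mult.assoc e2[symmetric] cc qa by (simp add: algebra_simps)
    have ge: "0 \<le> 1 + cos y" for y :: real using cos_ge_minus_one[of y] by linarith
    have iw0: "integrable M w" and iv0: "integrable N v"
      using iw[of "\<lambda>_. 0"] iv[of "\<lambda>_. 0"] by auto
    have 1: "(\<integral>x. w x * (1 + cos (p t \<phi> x)) * indicator (A k) (Y k x) \<partial>M)
      = (\<integral>x. v x * (1 + cos (q t \<phi> x)) * indicator (A k) (Z k x) \<partial>N)"
    proof (rule weighted_Levy_uniqueness)
      show "integrable M (\<lambda>x. w x * (1 + cos (p t \<phi> x)))" "integrable N (\<lambda>x. v x * (1 + cos (q t \<phi> x)))"
        using iw0 iv0 by (simp_all add: distrib_left iw iv)
      show "(\<integral>x. w x * (1 + cos (p t \<phi> x)) * cos (s * Y k x + \<psi>) \<partial>M)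
        = (\<integral>x. v x * (1 + cos (q t \<phi> x)) * cos (s * Z k x + \<psi>) \<partial>N)" for s \<psi>
        unfolding pm qm by (simp add: iw iv IH')
    qed (auto simp: w01 v01 ge)
    have 2: "(\<integral>x. w x * indicator (A k) (Y k x) \<partial>M) = (\<integral>x. v x * indicator (A k) (Z k x) \<partial>N)"
    proof (rule weighted_Levy_uniqueness)
      show "(\<integral>x. w x * cos (s * Y k x + \<psi>) \<partial>M) = (\<integral>x. v x * cos (s * Z k x + \<psi>) \<partial>N)" for s \<psi>
        using IH'[of "e s" \<psi>] by (simp add: e1 e2)
    qed (auto simp: w01 v01 iw0 iv0)
    have iwA: "integrable M (\<lambda>x. w x * cos (h x) * indicator (A k) (Y k x))" if [measurable]: "h \<in> borel_measurable M" for h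
      using w01 by (intro M.integrable_const_bound[where B=1]) (auto simp: abs_mult intro!: mult_le_one split: split_indicator)
    have ivA: "integrable N (\<lambda>x. v x * cos (h x) * indicator (A k) (Z k x))" if [measurable]: "h \<in> borel_measurable N" for h
      using v01 by (intro N.integrable_const_bound[where B=1]) (auto simp: abs_mult intro!: mult_le_one split: split_indicator)
    have "(\<integral>x. w x * cos (p t \<phi> x) * indicator (A k) (Y k x) \<partial>M)
      = (\<integral>x. v x * cos (q t \<phi> x) * indicator (A k) (Z k x) \<partial>N)"
      using 1 2 iwA[of "p t \<phi>"] ivA[of "q t \<phi>"] iwA[of "\<lambda>_. 0"] ivA[of "\<lambda>_. 0"]
      by (simp add: distrib_left distrib_right)
    then show ?case
      using insert.hyps by (simp add: w_def v_def p_def q_def mult_ac)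
  qed
qed

text \<open>The Cramer--Wold theorem; the two vectors may live on different probability spaces.\<close>
theorem distr_PiM_eqI_linear_combinations:
  fixes Y :: "'i \<Rightarrow> 'a \<Rightarrow> real" and Z :: "'i \<Rightarrow> 'b \<Rightarrow> real"
  assumes "prob_space M" "prob_space N"
    and Y[measurable]: "\<And>j. j \<in> J \<Longrightarrow> Y j \<in> borel_measurable M"
    and Z[measurable]: "\<And>j. j \<in> J \<Longrightarrow> Z j \<in> borel_measurable N"
    and J: "finite J"
    and eq: "\<And>t. distr M borel (\<lambda>x. \<Sum>j\<in>J. t j * Y j x) = distr N borel (\<lambda>x. \<Sum>j\<in>J. t j * Z j x)"
  shows "distr M (\<Pi>\<^sub>M j\<in>J. borel) (\<lambda>x. \<lambda>j\<in>J. Y j x) = distr N (\<Pi>\<^sub>M j\<in>J. borel) (\<lambda>x. \<lambda>j\<in>J. Z j x)"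
    (is "?P = ?Q")
proof -
  interpret M: prob_space M by fact
  interpret N: prob_space N by fact
  have box: "emeasure (distr L (\<Pi>\<^sub>M j\<in>J. borel) (\<lambda>x. \<lambda>j\<in>J. U j x)) (Pi\<^sub>E J A)
      = ennreal (\<integral>x. (\<Prod>j\<in>J. indicator (A j) (U j x)) \<partial>L)"
    if L: "prob_space L" and U[measurable]: "\<And>j. j \<in> J \<Longrightarrow> U j \<in> borel_measurable L"
      and A[measurable]: "\<And>j. j \<in> J \<Longrightarrow> A j \<in> sets borel"
    for L :: "'c measure" and U A
  proof -
    interpret L: prob_space L by fact
    have "emeasure (distr L (\<Pi>\<^sub>M j\<in>J. borel) (\<lambda>x. \<lambda>j\<in>J. U j x)) (Pi\<^sub>E J A)
      = emeasure L {x\<in>space L. \<forall>j\<in>J. U j x \<in> A j}"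
      using J by (subst emeasure_distr) (auto intro!: arg_cong[where f="emeasure L"] sets_PiM_I_finite simp: PiE_iff)
    also have "\<dots> = ennreal (\<integral>x. indicator {x\<in>space L. \<forall>j\<in>J. U j x \<in> A j} x \<partial>L)"
      using J by (subst L.emeasure_eq_measure) (simp add: Int_def conj_commute cong: conj_cong)
    also have "(\<integral>x. indicator {x\<in>space L. \<forall>j\<in>J. U j x \<in> A j} x \<partial>L) = (\<integral>x. (\<Prod>j\<in>J. indicator (A j) (U j x) :: real) \<partial>L)"
      using J by (intro Bochner_Integration.integral_cong refl)
        (auto simp: indicator_def intro!: prod_zero prod.neutral[symmetric])
    finally show ?thesis .
  qed
  show ?thesis
  proof (rule measure_eqI_PiM_finite[OF J, where A="\<lambda>_. Pi\<^sub>E J (\<lambda>_. UNIV)"])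
    fix A :: "'i \<Rightarrow> real set" assume A: "\<And>j. j \<in> J \<Longrightarrow> A j \<in> sets borel"
    show "emeasure ?P (Pi\<^sub>E J A) = emeasure ?Q (Pi\<^sub>E J A)"
      using integral_indicator_cos_eq[OF assms(1,2) Y Z J order_refl eq A, where t = "\<lambda>_. 0" and \<phi> = 0]
      by (simp add: box assms(1,2) Y Z A)
  next
    interpret P: prob_space ?P
      by (intro M.prob_space_distr measurable_restrict Y)
    show "emeasure ?P (Pi\<^sub>E J (\<lambda>_. UNIV)) \<noteq> \<infinity>"
      using P.emeasure_finite by simp
  qed (auto simp: space_PiM J intro!: prod_algebraI_finite)
qed

section \<open>Gaussian processes are determined by their first two moments\<close>

lemma abs_mult_le_sum_squares: "\<bar>x * y\<bar> \<le> x\<^sup>2 + (y::real)\<^sup>2"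
proof -
  have "2 * (\<bar>x\<bar> * \<bar>y\<bar>) \<le> x\<^sup>2 + y\<^sup>2"
    using sum_squares_bound[of "\<bar>x\<bar>" "\<bar>y\<bar>"] by (simp add: mult.assoc)
  moreover have "0 \<le> \<bar>x\<bar> * \<bar>y\<bar>" by simp
  ultimately show ?thesis unfolding abs_mult by linarith
qed

context prob_space
begin

lemma gaussian_rv_measurable: "gaussian_rv M Y \<Longrightarrow> Y \<in> borel_measurable M"
  unfolding gaussian_rv_def by (auto dest: distributed_measurable)

lemma gaussian_rv_square_integrable:
  assumes "gaussian_rv M Y"
  shows "integrable M (\<lambda>\<omega>. (Y \<omega>)\<^sup>2)"
proof -
  note [measurable] = gaussian_rv_measurable[OF assms]
  consider \<mu> \<sigma> where "0 < \<sigma>" "distributed M lborel Y (\<lambda>x. ennreal (normal_density \<mu> \<sigma> x))"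
    | \<mu> where "AE \<omega> in M. Y \<omega> = \<mu>"
    using assms unfolding gaussian_rv_def by blast
  then show ?thesis
  proof cases
    case 1
    have i: "integrable lborel (\<lambda>x. normal_density \<mu> \<sigma> x * (x - \<mu>)\<^sup>2)"
      "integrable lborel (\<lambda>x. normal_density \<mu> \<sigma> x * x)" "integrable lborel (normal_density \<mu> \<sigma>)"
      using 1 by (auto intro: integrable_normal_moment integrable_normal_moment_nz_1)
    have e: "normal_density \<mu> \<sigma> x * x\<^sup>2 = normal_density \<mu> \<sigma> x * (x - \<mu>)\<^sup>2
        + 2 * \<mu> * (normal_density \<mu> \<sigma> x * x) - \<mu>\<^sup>2 * normal_density \<mu> \<sigma> x" for x
      by (simp add: power2_eq_square algebra_simps)
    have "integrable lborel (\<lambda>x. normal_density \<mu> \<sigma> x * x\<^sup>2)"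
      unfolding e by (intro Bochner_Integration.integrable_add Bochner_Integration.integrable_diff integrable_mult_right i)
    then show ?thesis
      using distributed_integrable[OF 1(2), of "\<lambda>x. x\<^sup>2"] by (simp add: normal_density_nonneg)
  next
    case 2
    have "AE \<omega> in M. norm ((Y \<omega>)\<^sup>2) \<le> \<mu>\<^sup>2" using 2 by eventually_elim simp
    then show ?thesis by (intro integrable_const_bound) auto
  qed
qed

lemma gaussian_rv_integrable: "gaussian_rv M Y \<Longrightarrow> integrable M Y"
  using square_integrable_imp_integrable gaussian_rv_measurable gaussian_rv_square_integrable by blast

text \<open>
  The two forms of a Gaussian variable cannot be confused: its variance is zero exactly when it is
  degenerate, and then the mean is the value taken almost surely; otherwise mean and variance are
  the parameters of the density.
\<close>
lemma gaussian_rv_distr_eqI: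
  assumes Y: "gaussian_rv M Y" and Z: "gaussian_rv M Z"
    and m1: "expectation Y = expectation Z"
    and m2: "expectation (\<lambda>\<omega>. (Y \<omega>)\<^sup>2) = expectation (\<lambda>\<omega>. (Z \<omega>)\<^sup>2)"
  shows "distr M borel Y = distr M borel Z"
proof -
  have "variance U = expectation (\<lambda>\<omega>. (U \<omega>)\<^sup>2) - (expectation U)\<^sup>2" if "gaussian_rv M U" for U
    by (intro variance_eq gaussian_rv_integrable gaussian_rv_square_integrable that)
  from this[OF Y] this[OF Z] have var: "variance Y = variance Z"
    unfolding m1 m2 by (rule trans[OF _ sym])
  have law: "distr M borel U = (if variance U = 0 then return borel (expectation U)
      else density lborel (\<lambda>x. ennreal (normal_density (expectation U) (sqrt (variance U)) x)))"
    if U: "gaussian_rv M U" for U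
  proof -
    note [measurable] = gaussian_rv_measurable[OF U]
    consider \<mu> \<sigma> where "0 < \<sigma>" "distributed M lborel U (\<lambda>x. ennreal (normal_density \<mu> \<sigma> x))"
      | \<mu> where "AE \<omega> in M. U \<omega> = \<mu>"
      using U unfolding gaussian_rv_def by blast
    then show ?thesis
    proof cases
      case 1
      have "distr M borel U = distr M lborel U" by (rule distr_cong) auto
      moreover note e = normal_distributed_expectation[OF 1]
      moreover have "expectation (\<lambda>\<omega>. (U \<omega> - \<mu>)\<^sup>2) = \<sigma>\<^sup>2"
        using normal_distributed_variance[OF 1] unfolding e .
      ultimately show ?thesis
        using 1 distributed_distr_eq_density[OF 1(2)] by simp
    next
      case 2
      have e: "expectation U = \<mu>"
        using 2 by (subst integral_cong_AE[where g="\<lambda>_. \<mu>"]) (auto simp: prob_space)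
      have v: "variance U = 0"
        unfolding e using 2 by (subst integral_cong_AE[where g="\<lambda>_. 0"]) auto
      have "distr M borel U = distr M borel (\<lambda>_. \<mu>)"
        using 2 by (intro distr_cong_AE) auto
      also have "\<dots> = return borel \<mu>" by (rule distr_const) auto
      finally show ?thesis using e v by simp
    qed
  qed
  show ?thesis unfolding law[OF Y] law[OF Z] var unfolding m1 ..
qed

lemma gaussian_process_sumD:
  assumes "gaussian_process M I X" "finite J" "J \<subseteq> I"
  shows "gaussian_rv M (\<lambda>\<omega>. \<Sum>j\<in>J. c j * X j \<omega>)"
  using assms(1)[unfolded gaussian_process_def, THEN conjunct2, rule_format, of J c] assms(2,3) by simp

lemma gaussian_process_memberD:
  assumes "gaussian_process M I X" "i \<in> I"
  shows "gaussian_rv M (X i)"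
  using gaussian_process_sumD[OF assms(1), of "{i}" "\<lambda>_. 1"] assms(2) by simp

lemma gaussian_process_integrable_mult:
  assumes "gaussian_process M I X" "i \<in> I" "j \<in> I"
  shows "integrable M (\<lambda>\<omega>. X i \<omega> * X j \<omega>)"
proof -
  note g = gaussian_process_memberD[OF assms(1,2)] gaussian_process_memberD[OF assms(1,3)]
  note meas = g[THEN gaussian_rv_measurable]
  have "integrable M (\<lambda>\<omega>. (X i \<omega>)\<^sup>2 + (X j \<omega>)\<^sup>2)"
    by (intro Bochner_Integration.integrable_add gaussian_rv_square_integrable g)
  then show ?thesis
  proof (rule Bochner_Integration.integrable_bound)
    show "(\<lambda>\<omega>. X i \<omega> * X j \<omega>) \<in> borel_measurable M"
      using meas by (rule borel_measurable_times)
    have "norm (X i \<omega> * X j \<omega>) \<le> norm ((X i \<omega>)\<^sup>2 + (X j \<omega>)\<^sup>2)" for \<omega>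
      using order_trans[OF abs_mult_le_sum_squares abs_ge_self] unfolding real_norm_def .
    then show "AE \<omega> in M. norm (X i \<omega> * X j \<omega>) \<le> norm ((X i \<omega>)\<^sup>2 + (X j \<omega>)\<^sup>2)"
      by (rule AE_I2)
  qed
qed

lemma expectation_square_linear_combination:
  assumes X: "gaussian_process M I X" and J: "finite J" "J \<subseteq> I"
  shows "expectation (\<lambda>\<omega>. (\<Sum>j\<in>J. c j * X j \<omega>)\<^sup>2) = (\<Sum>i\<in>J. \<Sum>j\<in>J. c i * c j * expectation (\<lambda>\<omega>. X i \<omega> * X j \<omega>))"
proof -
  have int: "integrable M (\<lambda>\<omega>. c i * c j * (X i \<omega> * X j \<omega>))" if "i \<in> J" "j \<in> J" for i j
    by (rule integrable_mult_right, rule gaussian_process_integrable_mult[OF X]) (use that J in auto)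
  have "(\<Sum>j\<in>J. c j * X j \<omega>)\<^sup>2 = (\<Sum>i\<in>J. \<Sum>j\<in>J. c i * c j * (X i \<omega> * X j \<omega>))" for \<omega>
    unfolding power2_eq_square sum_product by (intro sum.cong refl) (simp only: mult_ac)
  then have "expectation (\<lambda>\<omega>. (\<Sum>j\<in>J. c j * X j \<omega>)\<^sup>2)
      = expectation (\<lambda>\<omega>. \<Sum>i\<in>J. \<Sum>j\<in>J. c i * c j * (X i \<omega> * X j \<omega>))"
    by (simp only:)
  also have "\<dots> = (\<Sum>i\<in>J. expectation (\<lambda>\<omega>. \<Sum>j\<in>J. c i * c j * (X i \<omega> * X j \<omega>)))"
    by (rule Bochner_Integration.integral_sum, rule Bochner_Integration.integrable_sum, rule int)
  also have "\<dots> = (\<Sum>i\<in>J. \<Sum>j\<in>J. expectation (\<lambda>\<omega>. c i * c j * (X i \<omega> * X j \<omega>)))"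
    by (rule sum.cong[OF refl], rule Bochner_Integration.integral_sum, rule int)
  finally show ?thesis by (simp only: integral_mult_right_zero)
qed

text \<open>
  A linear combination of the variables of a Gaussian process is Gaussian, and its first two moments
  are a linear and a quadratic expression in those of the process. So the laws of all linear
  combinations are determined, and with them the joint laws.
\<close>
theorem gaussian_process_fdd_eqI:
  assumes Y: "gaussian_process M I Y" and Z: "gaussian_process M I Z"
    and m1: "\<And>i. i \<in> I \<Longrightarrow> expectation (Y i) = expectation (Z i)"
    and m2: "\<And>i j. i \<in> I \<Longrightarrow> j \<in> I \<Longrightarrow>
      expectation (\<lambda>\<omega>. Y i \<omega> * Y j \<omega>) = expectation (\<lambda>\<omega>. Z i \<omega> * Z j \<omega>)"
  shows "fdd_eq M I Y Z"
  unfolding fdd_eq_def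
proof (intro allI impI, elim conjE)
  fix J assume J: "finite J" "J \<subseteq> I"
  have measY: "Y j \<in> borel_measurable M" and measZ: "Z j \<in> borel_measurable M" if "j \<in> J" for j
    using gaussian_process_memberD[OF Y] gaussian_process_memberD[OF Z] J that gaussian_rv_measurable
    by blast+
  show "distr M (\<Pi>\<^sub>M j\<in>J. borel) (\<lambda>\<omega>. \<lambda>j\<in>J. Y j \<omega>) = distr M (\<Pi>\<^sub>M j\<in>J. borel) (\<lambda>\<omega>. \<lambda>j\<in>J. Z j \<omega>)"
  proof (rule distr_PiM_eqI_linear_combinations)
    fix t
    show "distr M borel (\<lambda>\<omega>. \<Sum>j\<in>J. t j * Y j \<omega>) = distr M borel (\<lambda>\<omega>. \<Sum>j\<in>J. t j * Z j \<omega>)"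
    proof (rule gaussian_rv_distr_eqI)
      show "gaussian_rv M (\<lambda>\<omega>. \<Sum>j\<in>J. t j * Y j \<omega>)" "gaussian_rv M (\<lambda>\<omega>. \<Sum>j\<in>J. t j * Z j \<omega>)"
        by (rule gaussian_process_sumD[OF Y J] gaussian_process_sumD[OF Z J])+
      show "expectation (\<lambda>\<omega>. \<Sum>j\<in>J. t j * Y j \<omega>) = expectation (\<lambda>\<omega>. \<Sum>j\<in>J. t j * Z j \<omega>)"
        using J m1 gaussian_rv_integrable[OF gaussian_process_memberD[OF Y]]
          gaussian_rv_integrable[OF gaussian_process_memberD[OF Z]]
        by (simp add: subset_iff)
      show "expectation (\<lambda>\<omega>. (\<Sum>j\<in>J. t j * Y j \<omega>)\<^sup>2) = expectation (\<lambda>\<omega>. (\<Sum>j\<in>J. t j * Z j \<omega>)\<^sup>2)"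
        unfolding expectation_square_linear_combination[OF Y J] expectation_square_linear_combination[OF Z J]
        using J m2 by (intro sum.cong) (auto simp: subset_iff)
    qed
  qed (fact measY measZ J prob_space_axioms)+
qed

text \<open>
  Covers both transformed processes of interest: rescaling (\<open>b = 0\<close>) and increments (\<open>a = b = 1\<close>). The
  map \<open>\<psi>\<close> may fail to be injective and may hit \<open>i\<^sub>0\<close>, so coefficients of equal indices are collected.
\<close>
lemma gaussian_process_increments:
  assumes X: "gaussian_process M I X" and \<psi>: "\<And>k. k \<in> K \<Longrightarrow> \<psi> k \<in> I" and o: "i\<^sub>0 \<in> I"
  shows "gaussian_process M K (\<lambda>k \<omega>. a * X (\<psi> k) \<omega> - b * X i\<^sub>0 \<omega>)"
proof -
  have "gaussian_rv M (\<lambda>\<omega>. \<Sum>k\<in>J. c k * (a * X (\<psi> k) \<omega> - b * X i\<^sub>0 \<omega>))"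
    if J: "finite J" "J \<subseteq> K" for J c
  proof -
    let ?L = "insert i\<^sub>0 (\<psi> ` J)"
    define d where "d i = a * (\<Sum>k\<in>{k\<in>J. \<psi> k = i}. c k) - (if i = i\<^sub>0 then b * (\<Sum>k\<in>J. c k) else 0)" for i
    have "(\<Sum>k\<in>J. c k * (a * X (\<psi> k) \<omega> - b * X i\<^sub>0 \<omega>)) = (\<Sum>i\<in>?L. d i * X i \<omega>)" for \<omega>
    proof -
      have "(\<Sum>k\<in>J. c k * X (\<psi> k) \<omega>) = (\<Sum>i\<in>?L. \<Sum>k\<in>{k\<in>J. \<psi> k = i}. c k * X (\<psi> k) \<omega>)"
        using J by (intro sum.group[symmetric]) auto
      also have "\<dots> = (\<Sum>i\<in>?L. (\<Sum>k\<in>{k\<in>J. \<psi> k = i}. c k) * X i \<omega>)"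
        by (intro sum.cong refl) (simp add: sum_distrib_right)
      finally have 1: "(\<Sum>k\<in>J. c k * X (\<psi> k) \<omega>) = (\<Sum>i\<in>?L. (\<Sum>k\<in>{k\<in>J. \<psi> k = i}. c k) * X i \<omega>)" .
      have 2: "(\<Sum>i\<in>?L. (if i = i\<^sub>0 then b * (\<Sum>k\<in>J. c k) else 0) * X i \<omega>) = b * (\<Sum>k\<in>J. c k) * X i\<^sub>0 \<omega>"
        using J by (subst sum.mono_neutral_right[where S="{i\<^sub>0}"]) auto
      have "(\<Sum>k\<in>J. c k * (a * X (\<psi> k) \<omega> - b * X i\<^sub>0 \<omega>))
        = a * (\<Sum>k\<in>J. c k * X (\<psi> k) \<omega>) - b * (\<Sum>k\<in>J. c k) * X i\<^sub>0 \<omega>"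
        by (simp add: sum_subtractf sum_distrib_left sum_distrib_right algebra_simps)
      also have "\<dots> = (\<Sum>i\<in>?L. d i * X i \<omega>)"
        unfolding 1 2[symmetric] d_def by (simp only: left_diff_distrib sum_subtractf sum_distrib_left[symmetric] mult.assoc)
      finally show ?thesis .
    qed
    moreover have "gaussian_rv M (\<lambda>\<omega>. \<Sum>i\<in>?L. d i * X i \<omega>)"
    proof -
      have "finite ?L" "?L \<subseteq> I" using J \<psi> o by auto
      then show ?thesis by (rule gaussian_process_sumD[OF X])
    qed
    ultimately show ?thesis by simp
  qed
  moreover have "(\<lambda>\<omega>. a * X (\<psi> k) \<omega> - b * X i\<^sub>0 \<omega>) \<in> borel_measurable M" if "k \<in> K" for k
    by (intro borel_measurable_diff borel_measurable_times borel_measurable_const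
        gaussian_rv_measurable gaussian_process_memberD[OF X] \<psi> that o)
  ultimately show ?thesis unfolding gaussian_process_def by blast
qed

end

lemma fdd_eq_distr:
  fixes Y Z :: "'b \<Rightarrow> 'a \<Rightarrow> real"
  assumes "fdd_eq M I Y Z" "i \<in> I"
    and "Y i \<in> borel_measurable M" "Z i \<in> borel_measurable M"
  shows "distr M borel (Y i) = distr M borel (Z i)"
proof -
  have marginal: "distr (distr M (\<Pi>\<^sub>M j\<in>{i}. borel) (\<lambda>\<omega>. \<lambda>j\<in>{i}. U j \<omega>)) borel (\<lambda>x. x i)
      = distr M borel (U i)" if U: "U i \<in> borel_measurable M" for U :: "'b \<Rightarrow> 'a \<Rightarrow> real"
  proof -
    have "(\<lambda>\<omega>. \<lambda>j\<in>{i}. U j \<omega>) \<in> measurable M (\<Pi>\<^sub>M j\<in>{i}. borel)"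
      using U by (intro measurable_restrict) simp
    from distr_distr[OF measurable_component_singleton[of i "{i}"] this] show ?thesis
      by (simp add: comp_def)
  qed
  have "{i} \<subseteq> I" using assms(2) by simp
  then have "distr M (\<Pi>\<^sub>M j\<in>{i}. borel) (\<lambda>\<omega>. \<lambda>j\<in>{i}. Y j \<omega>) = distr M (\<Pi>\<^sub>M j\<in>{i}. borel) (\<lambda>\<omega>. \<lambda>j\<in>{i}. Z j \<omega>)"
    using assms(1) unfolding fdd_eq_def by (metis finite.intros)
  then show ?thesis
    unfolding marginal[of Y, OF assms(3), symmetric] marginal[of Z, OF assms(4), symmetric] by (rule arg_cong)
qed

text \<open>Only one-dimensional marginals are needed to recover the covariance from the invariances.\<close>
lemma fdd_eq_expectation:
  fixes h :: "real \<Rightarrow> real"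
  assumes "fdd_eq M I Y Z" "i \<in> I"
    and [measurable]: "Y i \<in> borel_measurable M" "Z i \<in> borel_measurable M" "h \<in> borel_measurable borel"
  shows "(\<integral>\<omega>. h (Y i \<omega>) \<partial>M) = (\<integral>\<omega>. h (Z i \<omega>) \<partial>M)"
  using arg_cong[OF fdd_eq_distr[OF assms(1-4)], of "\<lambda>D. integral\<^sup>L D h"]
  by (simp add: integral_distr)

section \<open>Euclidean geometry of the space of square-integrable classes\<close>

lemma L2_zero_in_L2 [simp]: "L2_zero m \<in> L2 m"
  by (simp add: L2_zero_def L2_class_in_L2 L2_fun_zero)

lemma L2_add_in_L2 [simp]: "F \<in> L2 m \<Longrightarrow> G \<in> L2 m \<Longrightarrow> L2_add m F G \<in> L2 m"
  by (elim L2_cases) (simp add: L2_add_class L2_class_in_L2 L2_fun_add)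

lemma L2_diff_in_L2 [simp]: "F \<in> L2 m \<Longrightarrow> G \<in> L2 m \<Longrightarrow> L2_diff m F G \<in> L2 m"
  by (elim L2_cases) (simp add: L2_diff_class L2_class_in_L2 L2_fun_diff)

lemma L2_scale_in_L2 [simp]: "F \<in> L2 m \<Longrightarrow> L2_scale m a F \<in> L2 m"
  by (elim L2_cases) (simp add: L2_scale_class L2_class_in_L2 L2_fun_scale)

lemma L2_fun_uminus: "f \<in> L2_fun m \<Longrightarrow> (\<lambda>x. - f x) \<in> L2_fun m"
  using L2_fun_scale[of f m "-1"] by simp

text \<open>These rules reduce an identity between vectors to a pointwise identity between representatives.\<close>
named_theorems L2_class_simps
lemmas [L2_class_simps] = L2_add_class L2_diff_class L2_scale_class L2_zero_def
  L2_fun_add L2_fun_diff L2_fun_scale L2_fun_zero L2_fun_uminus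

lemma L2_diff_self: "F \<in> L2 m \<Longrightarrow> L2_diff m F F = L2_zero m"
  by (elim L2_cases) (simp add: L2_class_simps)

lemma L2_diff_add_cancel: "F \<in> L2 m \<Longrightarrow> G \<in> L2 m \<Longrightarrow> L2_add m (L2_diff m F G) G = F"
  by (elim L2_cases) (simp add: L2_class_simps)

lemma L2_zero_add: "F \<in> L2 m \<Longrightarrow> L2_add m (L2_zero m) F = F"
  by (elim L2_cases) (simp add: L2_class_simps)

lemma L2_add_uminus: "F \<in> L2 m \<Longrightarrow> L2_add m F (L2_scale m (-1) F) = L2_zero m"
  by (elim L2_cases) (simp add: L2_class_simps)

lemma L2_diff_conv_add: "F \<in> L2 m \<Longrightarrow> G \<in> L2 m \<Longrightarrow> L2_diff m F G = L2_add m F (L2_scale m (-1) G)"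
  by (elim L2_cases) (simp add: L2_class_simps)

lemma L2_add_scaled_diff: "F \<in> L2 m \<Longrightarrow> G \<in> L2 m \<Longrightarrow> L2_add m F (L2_scale m (-1) (L2_diff m F G)) = G"
  by (elim L2_cases) (simp add: L2_class_simps)

lemma L2_add_scale_cancel:
  "F \<in> L2 m \<Longrightarrow> U \<in> L2 m \<Longrightarrow> L2_add m (L2_add m F (L2_scale m k U)) (L2_scale m (- k) U) = F"
  by (elim L2_cases) (simp add: L2_class_simps)

lemma L2_add_add_scale:
  "F \<in> L2 m \<Longrightarrow> G \<in> L2 m \<Longrightarrow> U \<in> L2 m \<Longrightarrow> L2_add m (L2_add m F G) (L2_scale m (k + l) U)
    = L2_add m (L2_add m F (L2_scale m k U)) (L2_add m G (L2_scale m l U))"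
  by (elim L2_cases) (simp add: L2_class_simps algebra_simps)

lemma L2_scale_add_scale:
  "F \<in> L2 m \<Longrightarrow> U \<in> L2 m \<Longrightarrow>
    L2_add m (L2_scale m a F) (L2_scale m (a * k) U) = L2_scale m a (L2_add m F (L2_scale m k U))"
  by (elim L2_cases) (simp add: L2_class_simps algebra_simps)

lemma L2_diff_translate:
  "F \<in> L2 m \<Longrightarrow> G \<in> L2 m \<Longrightarrow> K \<in> L2 m \<Longrightarrow> L2_diff m (L2_add m F K) (L2_add m G K) = L2_diff m F G"
  by (elim L2_cases) (simp add: L2_class_simps)

lemma L2_scale_one: "F \<in> L2 m \<Longrightarrow> L2_scale m 1 F = F"
  by (elim L2_cases) (simp add: L2_class_simps)

lemma L2_scale_scale: "F \<in> L2 m \<Longrightarrow> L2_scale m a (L2_scale m b F) = L2_scale m (a * b) F"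
  by (elim L2_cases) (simp add: L2_class_simps mult.assoc)

lemma L2_scale_zero: "L2_scale m a (L2_zero m) = L2_zero m"
  using L2_scale_class[OF L2_fun_zero] by (simp add: L2_zero_def)

lemma L2_scale_diff:
  "F \<in> L2 m \<Longrightarrow> G \<in> L2 m \<Longrightarrow> L2_diff m (L2_scale m a F) (L2_scale m a G) = L2_scale m a (L2_diff m F G)"
  by (elim L2_cases) (simp add: L2_class_simps right_diff_distrib)

lemma L2_fun_integrable_mult:
  assumes "f \<in> L2_fun m" "g \<in> L2_fun m"
  shows "integrable m (\<lambda>x. f x * g x)"
proof (rule Bochner_Integration.integrable_bound)
  show "integrable m (\<lambda>x. (f x)\<^sup>2 + (g x)\<^sup>2)" using assms by (simp add: L2_fun_def)
  show "(\<lambda>x. f x * g x) \<in> borel_measurable m"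
    using assms by (intro borel_measurable_times) (simp_all add: L2_fun_def)
  have "norm (f x * g x) \<le> norm ((f x)\<^sup>2 + (g x)\<^sup>2)" for x
    using order_trans[OF abs_mult_le_sum_squares abs_ge_self] unfolding real_norm_def .
  then show "AE x in m. norm (f x * g x) \<le> norm ((f x)\<^sup>2 + (g x)\<^sup>2)" by (rule AE_I2)
qed

lemma L2_inner_commute: "L2_inner m F G = L2_inner m G F"
  by (simp add: L2_inner_def mult.commute)

lemma L2_inner_add_left:
  "F \<in> L2 m \<Longrightarrow> G \<in> L2 m \<Longrightarrow> K \<in> L2 m \<Longrightarrow>
    L2_inner m (L2_add m F G) K = L2_inner m F K + L2_inner m G K"
  by (elim L2_cases) (simp add: L2_class_simps L2_inner_class distrib_right L2_fun_integrable_mult)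

lemma L2_inner_scale_left:
  "F \<in> L2 m \<Longrightarrow> G \<in> L2 m \<Longrightarrow> L2_inner m (L2_scale m a F) G = a * L2_inner m F G"
  by (elim L2_cases) (simp add: L2_class_simps L2_inner_class mult.assoc)

lemma L2_inner_diff_left:
  "F \<in> L2 m \<Longrightarrow> G \<in> L2 m \<Longrightarrow> K \<in> L2 m \<Longrightarrow>
    L2_inner m (L2_diff m F G) K = L2_inner m F K - L2_inner m G K"
  by (simp add: L2_diff_conv_add L2_inner_add_left L2_inner_scale_left)

lemma L2_inner_add_right:
  "F \<in> L2 m \<Longrightarrow> G \<in> L2 m \<Longrightarrow> K \<in> L2 m \<Longrightarrow>
    L2_inner m K (L2_add m F G) = L2_inner m K F + L2_inner m K G"
  using L2_inner_add_left[of F m G K] by (simp add: L2_inner_commute)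

lemma L2_inner_scale_right:
  "F \<in> L2 m \<Longrightarrow> G \<in> L2 m \<Longrightarrow> L2_inner m G (L2_scale m a F) = a * L2_inner m G F"
  using L2_inner_scale_left[of F m G a] by (simp add: L2_inner_commute)

lemma L2_inner_diff_right:
  "F \<in> L2 m \<Longrightarrow> G \<in> L2 m \<Longrightarrow> K \<in> L2 m \<Longrightarrow>
    L2_inner m K (L2_diff m F G) = L2_inner m K F - L2_inner m K G"
  using L2_inner_diff_left[of F m G K] by (simp add: L2_inner_commute)

lemma L2_inner_self_nonneg: "0 \<le> L2_inner m F F"
  by (simp add: L2_inner_def)

lemma L2_inner_self_eq_0_iff:
  assumes "F \<in> L2 m"
  shows "L2_inner m F F = 0 \<longleftrightarrow> F = L2_zero m"
proof -
  obtain f where f: "f \<in> L2_fun m" "F = L2_class m f" using assms by (rule L2_cases)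
  have "L2_inner m F F = 0 \<longleftrightarrow> (AE x in m. f x = 0)"
    using L2_fun_integrable_mult[OF f(1,1)] f
    by (simp add: L2_inner_class integral_nonneg_eq_0_iff_AE)
  then show ?thesis using f by (simp add: L2_zero_def L2_class_eq_iff L2_fun_zero)
qed

lemma L2_norm_eq_0_iff: "F \<in> L2 m \<Longrightarrow> L2_norm m F = 0 \<longleftrightarrow> F = L2_zero m"
  by (simp add: L2_norm_def L2_inner_self_eq_0_iff)

lemma L2_norm_nonneg: "0 \<le> L2_norm m F"
  by (simp add: L2_norm_def L2_inner_self_nonneg)

lemma L2_norm_scale: "F \<in> L2 m \<Longrightarrow> L2_norm m (L2_scale m a F) = \<bar>a\<bar> * L2_norm m F"
  by (simp add: L2_norm_def L2_inner_scale_left L2_inner_scale_right real_sqrt_mult flip: mult.assoc)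

lemma L2_diff_eq_zero_iff:
  assumes "F \<in> L2 m" "G \<in> L2 m"
  shows "L2_diff m F G = L2_zero m \<longleftrightarrow> F = G"
  using L2_diff_add_cancel[OF assms] L2_zero_add[OF assms(2)] L2_diff_self[OF assms(2)] by auto

lemma L2_norm_diff_commute:
  assumes "F \<in> L2 m" "G \<in> L2 m"
  shows "L2_norm m (L2_diff m F G) = L2_norm m (L2_diff m G F)"
proof -
  have "L2_diff m F G = L2_scale m (-1) (L2_diff m G F)"
    using assms by (elim L2_cases) (simp add: L2_class_simps)
  then show ?thesis using assms by (simp add: L2_norm_scale)
qed

text \<open>Translations and orthogonal maps enter the forward direction only as isometries.\<close>
lemma L2_translation_dist:
  "L2_translation m \<psi> \<Longrightarrow> F \<in> L2 m \<Longrightarrow> G \<in> L2 m \<Longrightarrow> L2_norm m (L2_diff m (\<psi> F) (\<psi> G)) = L2_norm m (L2_diff m F G)"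
  by (auto simp: L2_translation_def L2_diff_translate)

lemma L2_orthogonal_dist:
  assumes \<psi>: "L2_orthogonal m \<psi>" and F: "F \<in> L2 m" and G: "G \<in> L2 m"
  shows "L2_norm m (L2_diff m (\<psi> F) (\<psi> G)) = L2_norm m (L2_diff m F G)"
proof -
  have "\<psi> F \<in> L2 m" "\<psi> G \<in> L2 m"
    using \<psi> F G by (auto simp: L2_orthogonal_def bij_betw_def)
  then have "L2_diff m (\<psi> F) (\<psi> G) = \<psi> (L2_diff m F G)"
    using \<psi> F G by (simp add: L2_orthogonal_def L2_diff_conv_add)
  then show ?thesis using \<psi> F G by (simp add: L2_orthogonal_def L2_norm_def)
qed

lemma L2_orthogonal_uminus: "L2_orthogonal m (L2_scale m (-1))"
  unfolding L2_orthogonal_def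
proof (intro conjI ballI allI)
  show "bij_betw (L2_scale m (-1)) (L2 m) (L2 m)"
    by (rule bij_betw_byWitness[where f' = "L2_scale m (-1)"])
      (auto simp: L2_scale_scale L2_scale_one)
next
  fix F G assume "F \<in> L2 m" "G \<in> L2 m"
  then show "L2_scale m (-1) (L2_add m F G) = L2_add m (L2_scale m (-1) F) (L2_scale m (-1) G)"
    by (elim L2_cases) (simp add: L2_class_simps)
qed (auto simp: L2_scale_scale L2_inner_scale_left L2_inner_scale_right)

text \<open>The reflection in the hyperplane orthogonal to \<open>U\<close>.\<close>
definition L2_reflection :: "'t measure \<Rightarrow> ('t \<Rightarrow> real) set \<Rightarrow> ('t \<Rightarrow> real) set \<Rightarrow> ('t \<Rightarrow> real) set" where
  "L2_reflection m U F = L2_add m F (L2_scale m (- 2 * L2_inner m F U / L2_inner m U U) U)"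

lemma L2_orthogonal_reflection:
  assumes U: "U \<in> L2 m" "U \<noteq> L2_zero m"
  shows "L2_orthogonal m (L2_reflection m U)"
proof -
  let ?q = "L2_inner m U U"
  have q: "?q \<noteq> 0" using U by (simp add: L2_inner_self_eq_0_iff)
  have mem: "L2_reflection m U F \<in> L2 m" if "F \<in> L2 m" for F
    using that U by (simp add: L2_reflection_def)
  have inv: "L2_reflection m U (L2_reflection m U F) = F" if F: "F \<in> L2 m" for F
  proof -
    have "L2_inner m (L2_reflection m U F) U = - L2_inner m F U"
      using F U q by (simp add: L2_reflection_def L2_inner_add_left L2_inner_scale_left)
    then show ?thesis
      using L2_add_scale_cancel[OF F U(1), of "- 2 * L2_inner m F U / ?q"]
      by (simp add: L2_reflection_def[of m U "L2_reflection m U F"]) (simp add: L2_reflection_def)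
  qed
  show ?thesis
    unfolding L2_orthogonal_def
  proof (intro conjI ballI allI)
    show "bij_betw (L2_reflection m U) (L2 m) (L2 m)"
      by (rule bij_betw_byWitness[where f' = "L2_reflection m U"]) (auto simp: inv mem)
  next
    fix F G assume FG: "F \<in> L2 m" "G \<in> L2 m"
    then have "L2_inner m (L2_add m F G) U = L2_inner m F U + L2_inner m G U"
      using U by (simp add: L2_inner_add_left)
    then have k: "- 2 * L2_inner m (L2_add m F G) U / ?q = - 2 * L2_inner m F U / ?q + - 2 * L2_inner m G U / ?q"
      by (simp add: add_divide_distrib diff_divide_distrib)
    show "L2_reflection m U (L2_add m F G) = L2_add m (L2_reflection m U F) (L2_reflection m U G)"
      unfolding L2_reflection_def k by (rule L2_add_add_scale[OF FG U(1)])
    have "L2_inner m (L2_add m F (L2_scale m k U)) (L2_add m G (L2_scale m l U))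
        = L2_inner m F G + l * L2_inner m F U + k * L2_inner m G U + k * l * ?q" for k l
      using FG U(1) L2_inner_commute[of m U G]
      by (simp add: L2_inner_add_left L2_inner_add_right L2_inner_scale_left L2_inner_scale_right distrib_left)
    then show "L2_inner m (L2_reflection m U F) (L2_reflection m U G) = L2_inner m F G"
      unfolding L2_reflection_def using q by simp
  next
    fix a F assume F: "F \<in> L2 m"
    then have "L2_inner m (L2_scale m a F) U = a * L2_inner m F U"
      using U by (simp add: L2_inner_scale_left)
    then have k: "- 2 * L2_inner m (L2_scale m a F) U / ?q = a * (- 2 * L2_inner m F U / ?q)" by simp
    show "L2_reflection m U (L2_scale m a F) = L2_scale m a (L2_reflection m U F)"
      unfolding L2_reflection_def k by (rule L2_scale_add_scale[OF F U(1)])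
  qed
qed

text \<open>
  If \<open>F\<close> and \<open>G\<close> have the same norm then \<open>\<parallel>F - G\<parallel>\<^sup>2 = 2 \<langle>F, F - G\<rangle>\<close>, so the reflection along \<open>F - G\<close>
  subtracts exactly \<open>F - G\<close> from \<open>F\<close>.
\<close>
lemma L2_orthogonal_transitive_on_spheres:
  assumes F: "F \<in> L2 m" and G: "G \<in> L2 m" and "F \<noteq> G" and n: "L2_norm m F = L2_norm m G"
  obtains \<psi> where "L2_orthogonal m \<psi>" "\<psi> F = G"
proof
  let ?U = "L2_diff m F G"
  have U: "?U \<in> L2 m" "?U \<noteq> L2_zero m" using assms by (auto simp: L2_diff_eq_zero_iff)
  then have q: "L2_inner m ?U ?U \<noteq> 0" by (simp add: L2_inner_self_eq_0_iff)
  show "L2_orthogonal m (L2_reflection m ?U)" using U by (rule L2_orthogonal_reflection)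
  have "L2_inner m F F = L2_inner m G G" using n by (simp add: L2_norm_def)
  then have "2 * L2_inner m F ?U = L2_inner m ?U ?U"
    using F G by (simp add: L2_inner_diff_left L2_inner_diff_right L2_inner_commute[of m G F])
  then have "- 2 * L2_inner m F ?U / L2_inner m ?U ?U = -1" using q by simp
  then show "L2_reflection m ?U F = G"
    unfolding L2_reflection_def using F G by (simp only: L2_add_scaled_diff)
qed

section \<open>Self-similarity and increment stationarity of fractional Brownian motion\<close>

text \<open>Twice the covariance of the fractional Brownian motion of unit variance.\<close>
definition fbm_kernel :: "'t measure \<Rightarrow> real \<Rightarrow> ('t \<Rightarrow> real) set \<Rightarrow> ('t \<Rightarrow> real) set \<Rightarrow> real" where
  "fbm_kernel m H f g =
     L2_norm m f powr (2 * H) + L2_norm m g powr (2 * H) - L2_norm m (L2_diff m f g) powr (2 * H)"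

locale gaussian_L2_process = prob_space M
  for M :: "'w measure" +
  fixes m :: "'t measure" and H :: real and X :: "('t \<Rightarrow> real) set \<Rightarrow> 'w \<Rightarrow> real"
  assumes gaussian: "gaussian_process M (L2 m) X"
begin

lemma gaussian_X: "f \<in> L2 m \<Longrightarrow> gaussian_rv M (X f)"
  by (rule gaussian_process_memberD[OF gaussian])

lemma measurable_X [measurable]: "f \<in> L2 m \<Longrightarrow> X f \<in> borel_measurable M"
  by (intro gaussian_rv_measurable gaussian_X)

lemma integrable_X: "f \<in> L2 m \<Longrightarrow> integrable M (X f)"
  by (intro gaussian_rv_integrable gaussian_X)

lemma integrable_X_mult: "f \<in> L2 m \<Longrightarrow> g \<in> L2 m \<Longrightarrow> integrable M (\<lambda>\<omega>. X f \<omega> * X g \<omega>)"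
  by (rule gaussian_process_integrable_mult[OF gaussian])

end

locale centred_fbm = gaussian_L2_process +
  fixes s :: real
  assumes centred: "\<And>f. f \<in> L2 m \<Longrightarrow> expectation (X f) = 0"
    and covariance: "\<And>f g. f \<in> L2 m \<Longrightarrow> g \<in> L2 m \<Longrightarrow>
      expectation (\<lambda>\<omega>. X f \<omega> * X g \<omega>) = s / 2 * fbm_kernel m H f g"
begin

lemma self_similar: "L2_self_similar M m H X"
  unfolding L2_self_similar_def
proof (intro allI impI)
  fix a :: real assume a: "0 < a"
  show "fdd_eq M (L2 m) (\<lambda>f \<omega>. a powr (- H) * X (L2_scale m a f) \<omega>) X"
  proof (rule gaussian_process_fdd_eqI)
    show "gaussian_process M (L2 m) (\<lambda>f \<omega>. a powr (- H) * X (L2_scale m a f) \<omega>)"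
      using gaussian_process_increments[OF gaussian, of "L2 m" "L2_scale m a" "L2_zero m" "a powr (- H)" 0] by simp
    show "expectation (\<lambda>\<omega>. a powr (- H) * X (L2_scale m a f) \<omega>) = expectation (X f)"
      if "f \<in> L2 m" for f using that by (simp add: centred)
    fix f g assume f: "f \<in> L2 m" and g: "g \<in> L2 m"
    have "fbm_kernel m H (L2_scale m a f) (L2_scale m a g) = a powr (2 * H) * fbm_kernel m H f g"
      using a f g by (simp add: fbm_kernel_def L2_scale_diff L2_norm_scale powr_mult L2_norm_nonneg algebra_simps)
    moreover have "a powr (- H) * a powr (- H) * a powr (2 * H) = 1"
      using a by (simp flip: powr_add)
    ultimately have "a powr (- H) * a powr (- H) * fbm_kernel m H (L2_scale m a f) (L2_scale m a g) = fbm_kernel m H f g"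
      by (metis mult.assoc mult_1)
    moreover have "expectation (\<lambda>\<omega>. a powr (- H) * X (L2_scale m a f) \<omega> * (a powr (- H) * X (L2_scale m a g) \<omega>))
        = a powr (- H) * a powr (- H) * expectation (\<lambda>\<omega>. X (L2_scale m a f) \<omega> * X (L2_scale m a g) \<omega>)"
      by (simp only: integral_mult_right_zero[symmetric] mult_ac)
    ultimately show "expectation (\<lambda>\<omega>. a powr (- H) * X (L2_scale m a f) \<omega> * (a powr (- H) * X (L2_scale m a g) \<omega>))
        = expectation (\<lambda>\<omega>. X f \<omega> * X g \<omega>)"
      using f g by (simp add: covariance)
  qed (rule gaussian)
qed

text \<open>
  The norms of \<open>f\<close>, \<open>g\<close> and \<open>h\<close> cancel, and only mutual distances remain. Hence an isometry of the
  index space preserves the covariance of the increments.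
\<close>
lemma increment_covariance:
  assumes "f \<in> L2 m" "g \<in> L2 m" "h \<in> L2 m"
  shows "expectation (\<lambda>\<omega>. (X f \<omega> - X h \<omega>) * (X g \<omega> - X h \<omega>))
    = s / 2 * (L2_norm m (L2_diff m f h) powr (2 * H) + L2_norm m (L2_diff m g h) powr (2 * H)
        - L2_norm m (L2_diff m f g) powr (2 * H))"
proof -
  have h0: "L2_norm m (L2_diff m h h) = 0"
    using assms by (simp add: L2_diff_self L2_norm_eq_0_iff)
  have "expectation (\<lambda>\<omega>. (X f \<omega> - X h \<omega>) * (X g \<omega> - X h \<omega>))
    = expectation (\<lambda>\<omega>. X f \<omega> * X g \<omega>) - expectation (\<lambda>\<omega>. X f \<omega> * X h \<omega>)
      - (expectation (\<lambda>\<omega>. X h \<omega> * X g \<omega>) - expectation (\<lambda>\<omega>. X h \<omega> * X h \<omega>))"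
    using assms by (simp add: left_diff_distrib right_diff_distrib integrable_X_mult)
  then show ?thesis
    using assms L2_norm_diff_commute[of h m g] by (simp add: covariance fbm_kernel_def h0 algebra_simps)
qed

lemma strong_increment_stationary: "L2_strong_increment_stationary M m X"
  unfolding L2_strong_increment_stationary_def
proof (intro ballI impI)
  fix \<psi> assume \<psi>: "\<psi> \<in> L2 m \<rightarrow> L2 m" and "L2_translation m \<psi> \<or> L2_orthogonal m \<psi>"
  then have dist: "L2_norm m (L2_diff m (\<psi> f) (\<psi> g)) = L2_norm m (L2_diff m f g)"
    if "f \<in> L2 m" "g \<in> L2 m" for f g
    using that L2_translation_dist L2_orthogonal_dist by blast
  have mem: "\<psi> f \<in> L2 m" if "f \<in> L2 m" for f using \<psi> that by auto
  show "fdd_eq M (L2 m) (\<lambda>f \<omega>. X (\<psi> f) \<omega> - X (\<psi> (L2_zero m)) \<omega>) (\<lambda>f \<omega>. X f \<omega> - X (L2_zero m) \<omega>)"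
  proof (rule gaussian_process_fdd_eqI)
    show "gaussian_process M (L2 m) (\<lambda>f \<omega>. X (\<psi> f) \<omega> - X (\<psi> (L2_zero m)) \<omega>)"
      using gaussian_process_increments[OF gaussian, of "L2 m" \<psi> "\<psi> (L2_zero m)" 1 1] by (simp add: mem)
    show "gaussian_process M (L2 m) (\<lambda>f \<omega>. X f \<omega> - X (L2_zero m) \<omega>)"
      using gaussian_process_increments[OF gaussian, of "L2 m" "\<lambda>f. f" "L2_zero m" 1 1] by simp
  qed (simp_all add: mem integrable_X centred increment_covariance dist)
qed

end

section \<open>Mean and covariance of self-similar processes with stationary increments\<close>

locale self_similar_stationary = gaussian_L2_process +
  assumes H_pos: "0 < H"
    and self_similar: "L2_self_similar M m H X"
    and stationary: "L2_strong_increment_stationary M m X"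
begin

lemma expectation_scale:
  fixes h :: "real \<Rightarrow> real"
  assumes "0 < a" "f \<in> L2 m" and [measurable]: "h \<in> borel_measurable borel"
  shows "expectation (\<lambda>\<omega>. h (a powr (- H) * X (L2_scale m a f) \<omega>)) = expectation (\<lambda>\<omega>. h (X f \<omega>))"
proof -
  have "fdd_eq M (L2 m) (\<lambda>f \<omega>. a powr (- H) * X (L2_scale m a f) \<omega>) X"
    using self_similar assms by (simp add: L2_self_similar_def)
  from fdd_eq_expectation[OF this assms(2) _ _ assms(3)] show ?thesis
    using assms(2) by simp
qed

lemma second_moment_scale:
  assumes a: "0 < a" and f: "f \<in> L2 m"
  shows "expectation (\<lambda>\<omega>. (X (L2_scale m a f) \<omega>)\<^sup>2) = a powr (2 * H) * expectation (\<lambda>\<omega>. (X f \<omega>)\<^sup>2)"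
proof -
  have "expectation (\<lambda>\<omega>. (X f \<omega>)\<^sup>2) = (a powr (- H))\<^sup>2 * expectation (\<lambda>\<omega>. (X (L2_scale m a f) \<omega>)\<^sup>2)"
    using expectation_scale[OF a f, of "\<lambda>x. x\<^sup>2"] by (simp add: power_mult_distrib)
  moreover have "a powr (2 * H) * (a powr (- H))\<^sup>2 = 1"
    using a by (simp add: power2_eq_square flip: powr_add)
  ultimately show ?thesis by (metis mult.assoc mult_1)
qed

text \<open>
  The zero vector is fixed by scaling, so its second moment equals \<open>2 powr (2 * H)\<close> times itself; as
  \<open>H > 0\<close>, it vanishes.
\<close>
lemma zero_AE: "AE \<omega> in M. X (L2_zero m) \<omega> = 0"
proof -
  have "2 powr (2 * H) \<noteq> (1::real)" using H_pos by simp
  then have "expectation (\<lambda>\<omega>. (X (L2_zero m) \<omega>)\<^sup>2) = 0"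
    using second_moment_scale[of 2 "L2_zero m"] by (simp add: L2_scale_zero)
  then show ?thesis
    using integrable_X_mult[of "L2_zero m" "L2_zero m"]
    by (subst (asm) integral_nonneg_eq_0_iff_AE) (auto simp: power2_eq_square)
qed

text \<open>
  Since \<open>X\<close> vanishes at zero, the right-hand side of increment stationarity may be read as \<open>X\<close> itself.
\<close>
lemma expectation_increment:
  fixes h :: "real \<Rightarrow> real"
  assumes \<psi>: "L2_translation m \<psi> \<or> L2_orthogonal m \<psi>" "\<psi> \<in> L2 m \<rightarrow> L2 m"
    and f: "f \<in> L2 m" and [measurable]: "h \<in> borel_measurable borel"
  shows "expectation (\<lambda>\<omega>. h (X (\<psi> f) \<omega> - X (\<psi> (L2_zero m)) \<omega>)) = expectation (\<lambda>\<omega>. h (X f \<omega>))"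
proof -
  have mem: "\<psi> g \<in> L2 m" if "g \<in> L2 m" for g using \<psi> that by auto
  have "expectation (\<lambda>\<omega>. h (X (\<psi> f) \<omega> - X (\<psi> (L2_zero m)) \<omega>)) = expectation (\<lambda>\<omega>. h (X f \<omega> - X (L2_zero m) \<omega>))"
  proof -
    have "fdd_eq M (L2 m) (\<lambda>f \<omega>. X (\<psi> f) \<omega> - X (\<psi> (L2_zero m)) \<omega>) (\<lambda>f \<omega>. X f \<omega> - X (L2_zero m) \<omega>)"
      using stationary \<psi> by (auto simp: L2_strong_increment_stationary_def)
    from fdd_eq_expectation[OF this f _ _ assms(4)] show ?thesis
      using mem f by simp
  qed
  also have "\<dots> = expectation (\<lambda>\<omega>. h (X f \<omega>))"
    using zero_AE f by (intro integral_cong_AE) auto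
  finally show ?thesis .
qed

lemma expectation_translate:
  fixes h :: "real \<Rightarrow> real"
  assumes f: "f \<in> L2 m" and k: "k \<in> L2 m" and h: "h \<in> borel_measurable borel"
  shows "expectation (\<lambda>\<omega>. h (X (L2_add m f k) \<omega> - X k \<omega>)) = expectation (\<lambda>\<omega>. h (X f \<omega>))"
proof -
  have "L2_translation m (\<lambda>f. L2_add m f k)" using k by (auto simp: L2_translation_def)
  then show ?thesis
    using expectation_increment[of "\<lambda>f. L2_add m f k", OF _ _ f h] k by (simp add: L2_zero_add)
qed

lemma expectation_orthogonal:
  fixes h :: "real \<Rightarrow> real"
  assumes \<psi>: "L2_orthogonal m \<psi>" and f: "f \<in> L2 m" and h[measurable]: "h \<in> borel_measurable borel"
  shows "expectation (\<lambda>\<omega>. h (X (\<psi> f) \<omega>)) = expectation (\<lambda>\<omega>. h (X f \<omega>))"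
proof -
  have maps: "\<psi> \<in> L2 m \<rightarrow> L2 m" using \<psi> by (auto simp: L2_orthogonal_def bij_betw_def)
  \<comment> \<open>An orthogonal map fixes zero, so its increments from zero are its values.\<close>
  have "\<psi> (L2_scale m 0 (L2_zero m)) = L2_scale m 0 (\<psi> (L2_zero m))"
    using \<psi> by (simp add: L2_orthogonal_def)
  moreover have "L2_scale m 0 g = L2_zero m" if "g \<in> L2 m" for g
    using that by (elim L2_cases) (simp add: L2_class_simps)
  ultimately have \<psi>0: "\<psi> (L2_zero m) = L2_zero m" using maps by (auto simp: Pi_iff)
  have "expectation (\<lambda>\<omega>. h (X (\<psi> f) \<omega>)) = expectation (\<lambda>\<omega>. h (X (\<psi> f) \<omega> - X (\<psi> (L2_zero m)) \<omega>))"
    using zero_AE f maps unfolding \<psi>0 by (intro integral_cong_AE) (auto simp: Pi_iff)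
  then show ?thesis using expectation_increment[OF _ maps f h] \<psi> by simp
qed

text \<open>
  Invariance under \<open>- id\<close> makes the mean even. Translation by \<open>- f\<close>, which carries \<open>f\<close> to zero, makes it
  odd.
\<close>
lemma centred:
  assumes f: "f \<in> L2 m"
  shows "expectation (X f) = 0"
proof -
  let ?n = "L2_scale m (-1) f"
  have n: "?n \<in> L2 m" using f by simp
  have "expectation (X ?n) = expectation (X f)"
    using expectation_orthogonal[OF L2_orthogonal_uminus f, of "\<lambda>x. x"] by simp
  moreover have "expectation (\<lambda>\<omega>. X (L2_zero m) \<omega> - X ?n \<omega>) = expectation (X f)"
    using expectation_translate[OF f n, of "\<lambda>x. x"] f by (simp add: L2_add_uminus)
  then have "expectation (X (L2_zero m)) - expectation (X ?n) = expectation (X f)"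
    using n by (simp add: integrable_X)
  moreover have "expectation (X (L2_zero m)) = 0"
    using zero_AE by (subst integral_cong_AE[where g="\<lambda>_. 0"]) auto
  ultimately show ?thesis by simp
qed

lemma second_moment_radial:
  assumes f: "f \<in> L2 m" and g: "g \<in> L2 m" and "L2_norm m f = L2_norm m g"
  shows "expectation (\<lambda>\<omega>. (X f \<omega>)\<^sup>2) = expectation (\<lambda>\<omega>. (X g \<omega>)\<^sup>2)"
proof (cases "f = g")
  case False
  obtain \<psi> where "L2_orthogonal m \<psi>" "\<psi> f = g"
    using L2_orthogonal_transitive_on_spheres[OF f g False assms(3)] .
  then show ?thesis using expectation_orthogonal[of \<psi> f "\<lambda>x. x\<^sup>2"] f by simp
qed simp

text \<open>
  Self-similarity reduces every nonzero vector to the unit sphere, on which the second moment is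
  constant; that constant is \<open>s\<close>. If there is no unit vector, the space is trivial and \<open>s = 0\<close> serves.
\<close>
lemma second_moment:
  obtains s where "0 \<le> s" "\<And>f. f \<in> L2 m \<Longrightarrow> expectation (\<lambda>\<omega>. (X f \<omega>)\<^sup>2) = s * L2_norm m f powr (2 * H)"
proof -
  have zero: "expectation (\<lambda>\<omega>. (X (L2_zero m) \<omega>)\<^sup>2) = 0"
    using zero_AE by (subst integral_cong_AE[where g="\<lambda>_. 0"]) auto
  have unit: "L2_scale m (1 / L2_norm m f) f \<in> L2 m \<and> L2_norm m (L2_scale m (1 / L2_norm m f) f) = 1 \<and>
      expectation (\<lambda>\<omega>. (X (L2_scale m (1 / L2_norm m f) f) \<omega>)\<^sup>2) * L2_norm m f powr (2 * H) = expectation (\<lambda>\<omega>. (X f \<omega>)\<^sup>2)"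
    if f: "f \<in> L2 m" "f \<noteq> L2_zero m" for f
  proof -
    let ?r = "L2_norm m f"
    have r: "0 < ?r" using f L2_norm_nonneg[of m f] L2_norm_eq_0_iff[of f m] by linarith
    have "L2_scale m ?r (L2_scale m (1 / ?r) f) = f"
      using r f by (simp add: L2_scale_scale L2_scale_one)
    then show ?thesis
      using second_moment_scale[OF r, of "L2_scale m (1 / ?r) f"] r f by (simp add: L2_norm_scale mult.commute)
  qed
  show ?thesis
  proof (cases "\<exists>e\<in>L2 m. L2_norm m e = 1")
    case True
    then obtain e where e: "e \<in> L2 m" "L2_norm m e = 1" by blast
    show ?thesis
    proof (rule that)
      show "0 \<le> expectation (\<lambda>\<omega>. (X e \<omega>)\<^sup>2)" by simp
      fix f assume f: "f \<in> L2 m"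
      show "expectation (\<lambda>\<omega>. (X f \<omega>)\<^sup>2) = expectation (\<lambda>\<omega>. (X e \<omega>)\<^sup>2) * L2_norm m f powr (2 * H)"
      proof (cases "f = L2_zero m")
        case True
        then show ?thesis using zero L2_norm_eq_0_iff[OF f] by simp
      next
        case False
        then show ?thesis
          using unit[OF f] second_moment_radial[of "L2_scale m (1 / L2_norm m f) f" e] e by simp
      qed
    qed
  next
    case False
    show ?thesis
    proof (rule that[of 0])
      fix f assume f: "f \<in> L2 m"
      then have "f = L2_zero m" using unit[OF f] False by blast
      then show "expectation (\<lambda>\<omega>. (X f \<omega>)\<^sup>2) = 0 * L2_norm m f powr (2 * H)" by (simp add: zero)
    qed simp
  qed
qed

text \<open>
  By translation, \<open>X f - X g\<close> is distributed as \<open>X (f - g)\<close>. Its second moment is thus known, and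
  polarisation gives the covariance.
\<close>
lemma covariance:
  obtains s where "0 \<le> s" "\<And>f g. f \<in> L2 m \<Longrightarrow> g \<in> L2 m \<Longrightarrow>
    expectation (\<lambda>\<omega>. X f \<omega> * X g \<omega>) = s / 2 * fbm_kernel m H f g"
proof -
  obtain s where s: "0 \<le> s"
    and v: "\<And>f. f \<in> L2 m \<Longrightarrow> expectation (\<lambda>\<omega>. (X f \<omega>)\<^sup>2) = s * L2_norm m f powr (2 * H)"
    using second_moment by blast
  have "expectation (\<lambda>\<omega>. X f \<omega> * X g \<omega>) = s / 2 * fbm_kernel m H f g"
    if f: "f \<in> L2 m" and g: "g \<in> L2 m" for f g
  proof -
    have "expectation (\<lambda>\<omega>. (X f \<omega> - X g \<omega>)\<^sup>2) = s * L2_norm m (L2_diff m f g) powr (2 * H)"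
      using expectation_translate[of "L2_diff m f g" g "\<lambda>x. x\<^sup>2"] f g v[of "L2_diff m f g"]
      by (simp add: L2_diff_add_cancel)
    moreover have "expectation (\<lambda>\<omega>. (X f \<omega> - X g \<omega>)\<^sup>2)
        = expectation (\<lambda>\<omega>. (X f \<omega>)\<^sup>2) + expectation (\<lambda>\<omega>. (X g \<omega>)\<^sup>2) - 2 * expectation (\<lambda>\<omega>. X f \<omega> * X g \<omega>)"
    proof -
      have i: "integrable M (\<lambda>\<omega>. (X f \<omega>)\<^sup>2)" "integrable M (\<lambda>\<omega>. (X g \<omega>)\<^sup>2)" "integrable M (\<lambda>\<omega>. X f \<omega> * X g \<omega>)"
        using f g by (auto intro: gaussian_rv_square_integrable gaussian_X integrable_X_mult)
      have "expectation (\<lambda>\<omega>. (X f \<omega> - X g \<omega>)\<^sup>2) = expectation (\<lambda>\<omega>. (X f \<omega>)\<^sup>2 + (X g \<omega>)\<^sup>2 - 2 * (X f \<omega> * X g \<omega>))"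
        by (intro Bochner_Integration.integral_cong refl) (simp add: power2_eq_square algebra_simps)
      then show ?thesis using i by simp
    qed
    ultimately show ?thesis using v f g by (simp add: fbm_kernel_def algebra_simps)
  qed
  then show ?thesis using s that by blast
qed

end

section \<open>Characterisation of fractional Brownian motion\<close>

theorem proposition3p1:
  fixes m :: "'t::polish_space measure"
    and M :: "'w measure"
    and X :: "('t \<Rightarrow> real) set \<Rightarrow> 'w \<Rightarrow> real"
    and H :: real
  assumes "sets m = sets borel"
    and "L2_separable m"
    and "prob_space M"
    and "0 < H" and "H \<le> 1"
    and "gaussian_process M (L2 m) X"
  shows "((\<forall>f\<in>L2 m. (\<integral>\<omega>. X f \<omega> \<partial>M) = 0) \<and>
          (\<exists>s\<ge>0. \<forall>f\<in>L2 m. \<forall>g\<in>L2 m.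
             (\<integral>\<omega>. X f \<omega> * X g \<omega> \<partial>M) =
               s / 2 * (L2_norm m f powr (2 * H) + L2_norm m g powr (2 * H)
                        - L2_norm m (L2_diff m f g) powr (2 * H)))) \<longleftrightarrow>
         L2_self_similar M m H X \<and> L2_strong_increment_stationary M m X"
    (is "?fbm \<longleftrightarrow> ?inv")
proof -
  interpret gaussian_L2_process M m H X
    using assms(3,6) by (simp add: gaussian_L2_process_def gaussian_L2_process_axioms_def)
  show ?thesis
  proof
    assume ?fbm
    then obtain s where "centred_fbm M m H X s"
      using gaussian_L2_process_axioms
      by (auto simp: centred_fbm_def centred_fbm_axioms_def fbm_kernel_def)
    then show ?inv
      using centred_fbm.self_similar centred_fbm.strong_increment_stationary by blast
  next
    assume ?inv
    then interpret self_similar_stationary M m H X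
      by unfold_locales (use assms(4) in auto)
    obtain s where "0 \<le> s" "\<And>f g. f \<in> L2 m \<Longrightarrow> g \<in> L2 m \<Longrightarrow>
        expectation (\<lambda>\<omega>. X f \<omega> * X g \<omega>) = s / 2 * fbm_kernel m H f g"
      using covariance by blast
    then show ?fbm using centred unfolding fbm_kernel_def by blast
  qed
qed

end
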